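(* Let $]a,b[$ and $]c,d[$ be nonempty open subintervals of $[0,1]$ with $]a,b[\,\cap\,]c,d[\,\neq\emptyset$. Let $S$ be a continuous Archimedean t-conorm on $[a,b]$ with additive generator $s$, and $T$ a continuous Archimedean t-norm on $[c,d]$ with additive generator $t$. Let $\widehat S=(\langle a,b,S\rangle)$ and $\widehat T=(\langle c,d,T\rangle)$ be the corresponding single-block ordinal sums on $[0,1]$, and put $l=\max\{a,c\}$, $r=\min\{b,d\}$. Then $\widehat S\gg_w\widehat T$ if and only if $h=s\circ t^{-1}$ is convex on $[t(r),t(l)]$.
   Context: Open intervals are written $]p,q[$. For $[p,q]\subseteq[0,1]$ with $p<q$, a t-norm (t-conorm) on $[p,q]$ is an associative, commutative map $[p,q]^2\to[p,q]$, nondecreasing in each variable, with neutral element $q$ (respectively $p$); on $[0,1]$ it is simply called a t-norm (t-conorm). A t-conorm $S$ on $[0,1]$ weakly dominates a t-norm $T$ on $[0,1]$ (written $S\gg_w T$) if $S(T(x,y),z)\ge T(S(x,z),y)$ for all $x,y,z\in[0,1]$. A continuous t-norm $T$ on $[c,d]$ is Archimedean if $T(x,x)<x$ for all $x\in\,]c,d[$; an additive generator of it is a continuous strictly decreasing $t\colon[c,d]\to[0,\infty]$ with $t(d)=0$ and $T(x,y)=t^{-1}(\min\{t(x)+t(y),t(c)\})$. A continuous t-conorm $S$ on $[a,b]$ is Archimedean if $S(x,x)>x$ for all $x\in\,]a,b[$; an additive generator of it is a continuous strictly increasing $s\colon[a,b]\to[0,\infty]$ with $s(a)=0$ and $S(x,y)=s^{-1}(\min\{s(x)+s(y),s(b)\})$.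 Single-block ordinal sums: $\widehat S=(\langle a,b,S\rangle)$ is given by $\widehat S(x,y)=S(x,y)$ if $(x,y)\in[a,b]^2$ and $\widehat S(x,y)=\max\{x,y\}$ otherwise; $\widehat T=(\langle c,d,T\rangle)$ is given by $\widehat T(x,y)=T(x,y)$ if $(x,y)\in[c,d]^2$ and $\widehat T(x,y)=\min\{x,y\}$ otherwise. The function $h$ is considered on $[t(r),t(l)]\subseteq[0,\infty]$ with values in $[0,\infty]$. Convexity means $h(\lambda\xi_1+(1-\lambda)\xi_2)\le\lambda h(\xi_1)+(1-\lambda)h(\xi_2)$ for all finite $\xi_1,\xi_2$ in the interval and all $\lambda\in\,]0,1[$, with the usual arithmetic in $[0,\infty]$. *)

theory Defs
  imports "HOL-Analysis.Analysis"
begin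

text \<open>
  Operations on \<open>[p,q]\<close> are total functions on the reals whose values are only constrained on
  \<open>[p,q]\<close>; likewise additive generators, which take values in \<open>[0,\<infinity>]\<close>, that is, in
  \<^typ>\<open>ennreal\<close>.
\<close>

definition comm_assoc_mono_on :: "real \<Rightarrow> real \<Rightarrow> (real \<Rightarrow> real \<Rightarrow> real) \<Rightarrow> bool" where
  "comm_assoc_mono_on p q F \<longleftrightarrow>
     (\<forall>x\<in>{p..q}. \<forall>y\<in>{p..q}. F x y \<in> {p..q}) \<and>
     (\<forall>x\<in>{p..q}. \<forall>y\<in>{p..q}. \<forall>z\<in>{p..q}. F (F x y) z = F x (F y z)) \<and>
     (\<forall>x\<in>{p..q}. \<forall>y\<in>{p..q}. F x y = F y x) \<and>
     (\<forall>y\<in>{p..q}. mono_on {p..q} (\<lambda>x. F x y)) \<and>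
     (\<forall>x\<in>{p..q}. mono_on {p..q} (\<lambda>y. F x y))"

definition tnorm_on :: "real \<Rightarrow> real \<Rightarrow> (real \<Rightarrow> real \<Rightarrow> real) \<Rightarrow> bool" where
  "tnorm_on p q T \<longleftrightarrow> comm_assoc_mono_on p q T \<and> (\<forall>x\<in>{p..q}. T x q = x)"

definition tconorm_on :: "real \<Rightarrow> real \<Rightarrow> (real \<Rightarrow> real \<Rightarrow> real) \<Rightarrow> bool" where
  "tconorm_on p q S \<longleftrightarrow> comm_assoc_mono_on p q S \<and> (\<forall>x\<in>{p..q}. S x p = x)"

definition continuous_archimedean_tnorm_on ::
    "real \<Rightarrow> real \<Rightarrow> (real \<Rightarrow> real \<Rightarrow> real) \<Rightarrow> bool" where
  "continuous_archimedean_tnorm_on c d T \<longleftrightarrow>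
     tnorm_on c d T \<and>
     continuous_on ({c..d} \<times> {c..d}) (\<lambda>(x, y). T x y) \<and>
     (\<forall>x\<in>{c<..<d}. T x x < x)"

definition continuous_archimedean_tconorm_on ::
    "real \<Rightarrow> real \<Rightarrow> (real \<Rightarrow> real \<Rightarrow> real) \<Rightarrow> bool" where
  "continuous_archimedean_tconorm_on a b S \<longleftrightarrow>
     tconorm_on a b S \<and>
     continuous_on ({a..b} \<times> {a..b}) (\<lambda>(x, y). S x y) \<and>
     (\<forall>x\<in>{a<..<b}. S x x > x)"

definition tnorm_additive_generator ::
    "real \<Rightarrow> real \<Rightarrow> (real \<Rightarrow> real \<Rightarrow> real) \<Rightarrow> (real \<Rightarrow> ennreal) \<Rightarrow> bool" where
  "tnorm_additive_generator c d T t \<longleftrightarrow>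
     continuous_on {c..d} t \<and> strict_antimono_on {c..d} t \<and> t d = 0 \<and>
     (\<forall>x\<in>{c..d}. \<forall>y\<in>{c..d}. T x y = inv_into {c..d} t (min (t x + t y) (t c)))"

definition tconorm_additive_generator ::
    "real \<Rightarrow> real \<Rightarrow> (real \<Rightarrow> real \<Rightarrow> real) \<Rightarrow> (real \<Rightarrow> ennreal) \<Rightarrow> bool" where
  "tconorm_additive_generator a b S s \<longleftrightarrow>
     continuous_on {a..b} s \<and> strict_mono_on {a..b} s \<and> s a = 0 \<and>
     (\<forall>x\<in>{a..b}. \<forall>y\<in>{a..b}. S x y = inv_into {a..b} s (min (s x + s y) (s b)))"

definition tconorm_ordinal_sum ::
    "real \<Rightarrow> real \<Rightarrow> (real \<Rightarrow> real \<Rightarrow> real) \<Rightarrow> real \<Rightarrow> real \<Rightarrow> real" where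
  "tconorm_ordinal_sum a b S x y =
     (if x \<in> {a..b} \<and> y \<in> {a..b} then S x y else max x y)"

definition tnorm_ordinal_sum ::
    "real \<Rightarrow> real \<Rightarrow> (real \<Rightarrow> real \<Rightarrow> real) \<Rightarrow> real \<Rightarrow> real \<Rightarrow> real" where
  "tnorm_ordinal_sum c d T x y =
     (if x \<in> {c..d} \<and> y \<in> {c..d} then T x y else min x y)"

definition weakly_dominates ::
    "(real \<Rightarrow> real \<Rightarrow> real) \<Rightarrow> (real \<Rightarrow> real \<Rightarrow> real) \<Rightarrow> bool"  (infix "\<ggreater>\<^sub>w" 50) where
  "S \<ggreater>\<^sub>w T \<longleftrightarrow>
     (\<forall>x\<in>{0..1}. \<forall>y\<in>{0..1}. \<forall>z\<in>{0..1}. S (T x y) z \<ge> T (S x z) y)"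

text \<open>
  The library's \<^const>\<open>convex_on\<close> needs a real vector space. The points are finite, but
  the values of \<open>h\<close> may be \<open>\<infinity>\<close>.
\<close>

definition ennreal_convex_on :: "ennreal set \<Rightarrow> (ennreal \<Rightarrow> ennreal) \<Rightarrow> bool" where
  "ennreal_convex_on I h \<longleftrightarrow>
     (\<forall>\<xi>\<^sub>1\<in>I. \<forall>\<xi>\<^sub>2\<in>I. \<forall>u\<in>{0<..<1::real}. \<xi>\<^sub>1 < \<infinity> \<longrightarrow> \<xi>\<^sub>2 < \<infinity> \<longrightarrow>
        h (ennreal u * \<xi>\<^sub>1 + ennreal (1 - u) * \<xi>\<^sub>2)
          \<le> ennreal u * h \<xi>\<^sub>1 + ennreal (1 - u) * h \<xi>\<^sub>2)"

end

theory Submission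
  imports Defs
begin

text \<open>
  Outside the common block \<open>[l,r]\<close> the inequality is automatic. For \<open>x\<close> in \<open>[l,r]\<close>, put \<open>u = t x\<close>,
  \<open>v = t y\<close>, \<open>w = s z\<close> and \<open>h u' = h u + w\<close>, so that \<open>u' \<le> u\<close>; up to truncation, weak domination
  then reads \<open>h (u' + v) + h u \<le> h u' + h (u + v)\<close>: the increments of \<open>h\<close> grow with the base point.
  This is convexity of \<open>h\<close>; in the direction that needs continuity, midpoint convexity suffices.
\<close>

section \<open>Convexity: midpoints, increments and infinite values\<close>

text \<open>Subtracting the chord over \<open>{x..y}\<close> leaves a function that vanishes at both
  ends and keeps the midpoint inequality, because the chord is affine. Such a function cannot have a
  positive maximum.\<close>

lemma continuous_midpoint_convex_imp_convex_on:
  fixes g :: "real \<Rightarrow> real"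
  assumes cont: "continuous_on {p..q} g"
    and mid: "\<And>x e. 0 < e \<Longrightarrow> p \<le> x - e \<Longrightarrow> x + e \<le> q \<Longrightarrow> 2 * g x \<le> g (x - e) + g (x + e)"
  shows "convex_on {p..q} g"
proof (rule convex_on_linorderI)
  fix u x y :: real
  assume u: "0 < u" "u < 1" and xy: "x \<in> {p..q}" "y \<in> {p..q}" "x < y"
  define k where "k = (g y - g x) / (y - x)"
  define f where "f w = g w - g x - k * (w - x)" for w
  have fx: "f x = 0" by (simp add: f_def)
  have fy: "f y = 0" using xy by (simp add: f_def k_def)
  have contf: "continuous_on {x..y} f"
    unfolding f_def using xy by (intro continuous_intros continuous_on_subset[OF cont]) auto
  obtain m where m: "m \<in> {x..y}" "\<forall>w\<in>{x..y}. f w \<le> f m"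
    using continuous_attains_sup[OF compact_Icc _ contf] xy by auto
  text \<open>Otherwise the leftmost maximum point \<open>n\<close> of \<open>f\<close> violates the midpoint inequality.\<close>
  have "f m \<le> 0"
  proof (rule ccontr)
    assume "\<not> f m \<le> 0"
    define K where "K = {w\<in>{x..y}. f w = f m}"
    have "closed K"
      unfolding K_def using continuous_closed_preimage_constant[OF contf] by simp
    moreover have "bounded K"
      by (rule bounded_subset[of "{x..y}"]) (auto simp: K_def)
    ultimately have "compact K" by (simp add: compact_eq_bounded_closed)
    moreover have "K \<noteq> {}" using m by (auto simp: K_def)
    ultimately obtain n where n: "n \<in> K" "\<forall>w\<in>K. n \<le> w"
      using compact_attains_inf by blast
    have "n \<noteq> x" "n \<noteq> y" "x \<le> n" "n \<le> y" "f n = f m"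
      using n(1) fx fy \<open>\<not> f m \<le> 0\<close> by (auto simp: K_def)
    \<comment> \<open>The largest radius for which \<open>n - e\<close> and \<open>n + e\<close>
      both stay in \<open>{x..y}\<close>.\<close>
    define e where "e = min (n - x) (y - n)"
    have e: "0 < e" "x \<le> n - e" "n + e \<le> y"
      using \<open>n \<noteq> x\<close> \<open>n \<noteq> y\<close> \<open>x \<le> n\<close> \<open>n \<le> y\<close> by (auto simp: e_def)
    have "n - e \<notin> K" using n(2) e(1) by force
    then have "f (n - e) < f m"
      using m(2)[rule_format, of "n - e"] e \<open>x \<le> n\<close> \<open>n \<le> y\<close> by (auto simp: K_def)
    moreover have "f (n + e) \<le> f m" using m(2) e \<open>x \<le> n\<close> by auto
    moreover have "2 * f n \<le> f (n - e) + f (n + e)"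
      using mid[of e n] e xy by (auto simp: f_def algebra_simps)
    ultimately show False using \<open>f n = f m\<close> by linarith
  qed
  have "u * (y - x) \<le> y - x" using u xy(3) by (intro mult_left_le_one_le) auto
  moreover have "0 \<le> u * (y - x)" using u xy(3) by simp
  ultimately have "x + u * (y - x) \<in> {x..y}" by (simp only: atLeastAtMost_iff) linarith
  with \<open>f m \<le> 0\<close> m(2) have "f (x + u * (y - x)) \<le> 0" by fastforce
  moreover have "(1 - u) *\<^sub>R x + u *\<^sub>R y = x + u * (y - x)" by (simp add: algebra_simps)
  moreover have "k * (u * (y - x)) = u * (g y - g x)" using xy by (simp add: k_def)
  ultimately show "g ((1 - u) *\<^sub>R x + u *\<^sub>R y) \<le> (1 - u) * g x + u * g y"
    by (simp add: f_def algebra_simps)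
qed simp

text \<open>The points \<open>u\<close> and \<open>u' + v\<close> lie symmetrically between
  \<open>u'\<close> and \<open>u + v\<close>, so they are convex combinations of these two ends with
  interchanged weights. Adding the two convexity inequalities gives each end total weight
  one.\<close>

lemma ennreal_convex_on_increments:
  fixes u u' v :: ennreal
  assumes conv: "ennreal_convex_on {A..B} h"
    and le: "A \<le> u'" "u' \<le> u" "u + v \<le> B" and fin: "u + v < \<infinity>"
  shows "h (u' + v) + h u \<le> h u' + h (u + v)"
\<comment> \<open>In the degenerate cases both sides consist of the same summands; otherwise the
  weight \<open>L\<close> below lies strictly between 0 and 1.\<close>
proof (cases "u' = u \<or> v = 0")
  case True
  then show ?thesis by (auto simp: add.commute)
next
  case False
  obtain x y where x: "u = ennreal x" "0 \<le> x" and y: "v = ennreal y" "0 \<le> y"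
    using fin by (cases u; cases v) auto
  obtain w where w: "u' = ennreal w" "0 \<le> w"
    using le(2) x by (cases u') (auto simp: top_unique)
  have "w < x" "0 < y" using False x y w le(2) by (auto simp: order_less_le)
  \<comment> \<open>Relative position of \<open>u\<close> on the segment from \<open>u'\<close> to
    \<open>u + v\<close>; that of \<open>u' + v\<close> is \<open>1 - L\<close>.\<close>
  define L where "L = (x - w) / (x + y - w)"
  have L: "0 < L" "L < 1" using \<open>w < x\<close> \<open>0 < y\<close> by (auto simp: L_def)
  have L_eq: "L * (x + y - w) = x - w" using \<open>w < x\<close> \<open>0 < y\<close> by (simp add: L_def)
  have in_I: "u' \<in> {A..B}" "u + v \<in> {A..B}"
    using le order_trans[OF le(2), of "u + v"] by (auto intro: order_trans)
  have fin': "u' < \<infinity>" using w by simp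
  have comb: "ennreal k * u' + ennreal (1 - k) * (u + v) = ennreal (k * w + (1 - k) * (x + y))"
    if "0 < k" "k < 1" for k
    using that x y w by (simp add: ennreal_mult)
  have "ennreal (1 - L) * u' + ennreal (1 - (1 - L)) * (u + v) = u"
    using L_eq L x comb[of "1 - L"] by (simp add: algebra_simps)
  then have 1: "h u \<le> ennreal (1 - L) * h u' + ennreal L * h (u + v)"
    using conv[unfolded ennreal_convex_on_def, rule_format, OF in_I, of "1 - L"] fin fin' L
    by simp
  have "ennreal L * u' + ennreal (1 - L) * (u + v) = u' + v"
    using L_eq L x y w comb[of L] by (simp add: algebra_simps flip: ennreal_plus)
  then have 2: "h (u' + v) \<le> ennreal L * h u' + ennreal (1 - L) * h (u + v)"
    using conv[unfolded ennreal_convex_on_def, rule_format, OF in_I, of L] fin fin' L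
    by simp
  have one: "ennreal L + ennreal (1 - L) = 1"
    using L by (simp add: ennreal_plus[symmetric] del: ennreal_plus)
  have "h (u' + v) + h u \<le>
      (ennreal L + ennreal (1 - L)) * h u' + (ennreal L + ennreal (1 - L)) * h (u + v)"
    using add_mono[OF 2 1] unfolding distrib_right by (simp only: ac_simps)
  then show ?thesis by (simp add: one)
qed

text \<open>An infinite value at either end makes the right-hand side infinite, since both weights
  are positive. Otherwise monotonicity keeps \<open>h\<close> finite on the whole segment, and the
  midpoint criterion for real functions applies there.\<close>

lemma ennreal_convex_onI_midpoint:
  assumes cont: "continuous_on {A..B} h" and anti: "antimono_on {A..B} h"
    and mid: "\<And>x e. 0 < e \<Longrightarrow> e \<le> x \<Longrightarrow> A \<le> ennreal (x - e) \<Longrightarrow> ennreal (x + e) \<le> B \<Longrightarrow>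
      h (ennreal x) + h (ennreal x) \<le> h (ennreal (x - e)) + h (ennreal (x + e))"
  shows "ennreal_convex_on {A..B} h"
  unfolding ennreal_convex_on_def
proof (intro ballI impI)
  fix \<xi> \<eta> u
  assume in_I: "\<xi> \<in> {A..B}" "\<eta> \<in> {A..B}" and u: "u \<in> {0<..<1::real}"
    and fin: "\<xi> < \<infinity>" "\<eta> < \<infinity>"
  show "h (ennreal u * \<xi> + ennreal (1 - u) * \<eta>) \<le> ennreal u * h \<xi> + ennreal (1 - u) * h \<eta>"
  proof (cases "h \<xi> = top \<or> h \<eta> = top")
    case True
    then show ?thesis using u by (auto simp: ennreal_mult_top)
  next
    case False
    obtain x y where x: "\<xi> = ennreal x" "0 \<le> x" and y: "\<eta> = ennreal y" "0 \<le> y"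
      using fin by (cases \<xi>; cases \<eta>) auto
    define p q where "p = min x y" and "q = max x y"
    have pq: "0 \<le> p" "p \<le> q" "ennreal p \<in> {A..B}" "ennreal q \<in> {A..B}" "h (ennreal p) < top"
      using x y in_I False by (auto simp: p_def q_def min_def max_def less_top)
    have sub: "ennreal w \<in> {A..B}" if "w \<in> {p..q}" for w
      using that pq(3,4) by (auto intro: order_trans ennreal_leI)
    \<comment> \<open>On the segment \<open>h\<close> is largest at the left end \<open>p\<close>,
      where it is finite.\<close>
    have hfin: "h (ennreal w) < top" if "w \<in> {p..q}" for w
      using monotone_onD[OF anti pq(3) sub[OF that]] that pq(5)
      by (auto intro: ennreal_leI order_le_less_trans)
    define g where "g w = enn2real (h (ennreal w))" for w
    have h_eq: "h (ennreal w) = ennreal (g w)" if "w \<in> {p..q}" for w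
      using hfin[OF that] by (simp add: g_def)
    have g_nonneg: "0 \<le> g w" for w by (simp add: g_def)
    have conth: "continuous_on {p..q} (\<lambda>w. h (ennreal w))"
      by (rule continuous_on_compose2[OF cont]) (use sub in \<open>auto intro: continuous_on_ennreal\<close>)
    have "continuous_on {p..q} g"
      unfolding continuous_on_def g_def
    proof
      fix w assume w: "w \<in> {p..q}"
      show "((\<lambda>w. enn2real (h (ennreal w))) \<longlongrightarrow> enn2real (h (ennreal w))) (at w within {p..q})"
        using conth w hfin[OF w] by (intro tendsto_enn2real) (auto simp: continuous_on_def)
    qed
    then have "convex_on {p..q} g"
    proof (rule continuous_midpoint_convex_imp_convex_on)
      fix w e :: real
      assume e: "0 < e" "p \<le> w - e" "w + e \<le> q"
      have "h (ennreal w) + h (ennreal w) \<le> h (ennreal (w - e)) + h (ennreal (w + e))"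
        using e pq(1) sub[of "w - e"] sub[of "w + e"] by (intro mid) auto
      then have "ennreal (g w + g w) \<le> ennreal (g (w - e) + g (w + e))"
        using e g_nonneg by (subst (1 2) ennreal_plus) (simp_all add: h_eq)
      then show "2 * g w \<le> g (w - e) + g (w + e)"
        using g_nonneg by (subst (asm) ennreal_le_iff) auto
    qed
    moreover have xy: "x \<in> {p..q}" "y \<in> {p..q}" by (auto simp: p_def q_def)
    ultimately have "g (u * x + (1 - u) * y) \<le> u * g x + (1 - u) * g y"
      using convex_onD[of "{p..q}" g "1 - u" x y] u by simp
    moreover have "u * x + (1 - u) * y \<in> {p..q}"
      using convexD[of "{p..q}" x y u "1 - u"] xy u by simp
    moreover have "ennreal u * \<xi> + ennreal (1 - u) * \<eta> = ennreal (u * x + (1 - u) * y)"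
      using u x y by (simp add: ennreal_mult)
    moreover have "ennreal u * h \<xi> + ennreal (1 - u) * h \<eta> = ennreal (u * g x + (1 - u) * g y)"
      using u x y xy g_nonneg by (simp add: h_eq ennreal_mult)
    ultimately show ?thesis using h_eq by (simp add: ennreal_leI)
  qed
qed

section \<open>T-conorms, t-norms and their ordinal sums\<close>

lemma tconorm_onD:
  assumes "tconorm_on a b S" "x \<in> {a..b}" "y \<in> {a..b}"
  shows "S x y \<in> {a..b}" "S x y = S y x" "x \<le> S x y" "y \<le> S x y" "S a y = y"
proof -
  have S: "\<And>x y. x \<in> {a..b} \<Longrightarrow> y \<in> {a..b} \<Longrightarrow> S x y = S y x"
    "\<And>x. x \<in> {a..b} \<Longrightarrow> S x a = x" "\<And>x. x \<in> {a..b} \<Longrightarrow> mono_on {a..b} (\<lambda>y. S x y)"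
    using assms(1) unfolding tconorm_on_def comm_assoc_mono_on_def by blast+
  have ge: "x \<le> S x y" if "x \<in> {a..b}" "y \<in> {a..b}" for x y
    using mono_onD[OF S(3)[OF that(1)], of a y] S(2)[OF that(1)] that by auto
  show "S x y \<in> {a..b}"
    using assms unfolding tconorm_on_def comm_assoc_mono_on_def by blast
  show "S x y = S y x" using S(1) assms by blast
  show "x \<le> S x y" using ge assms by blast
  show "y \<le> S x y" using ge[of y x] S(1)[of x y] assms by auto
  show "S a y = y" using S(1)[of a y] S(2)[of y] assms by auto
qed

lemma tnorm_onD:
  assumes "tnorm_on c d T" "x \<in> {c..d}" "y \<in> {c..d}"
  shows "T x y \<in> {c..d}" "T x y = T y x" "T x y \<le> x" "T x y \<le> y" "T d y = y"
    "x' \<in> {c..d} \<Longrightarrow> x \<le> x' \<Longrightarrow> T x y \<le> T x' y"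
proof -
  have T: "\<And>x y. x \<in> {c..d} \<Longrightarrow> y \<in> {c..d} \<Longrightarrow> T x y = T y x"
    "\<And>x. x \<in> {c..d} \<Longrightarrow> T x d = x" "\<And>y. y \<in> {c..d} \<Longrightarrow> mono_on {c..d} (\<lambda>x. T x y)"
    "\<And>x. x \<in> {c..d} \<Longrightarrow> mono_on {c..d} (\<lambda>y. T x y)"
    using assms(1) unfolding tnorm_on_def comm_assoc_mono_on_def by blast+
  have le: "T x y \<le> x" if "x \<in> {c..d}" "y \<in> {c..d}" for x y
    using mono_onD[OF T(4)[OF that(1)], of y d] T(2)[OF that(1)] that by auto
  show "T x y \<in> {c..d}"
    using assms unfolding tnorm_on_def comm_assoc_mono_on_def by blast
  show "T x y = T y x" using T(1) assms by blast
  show "T x y \<le> x" using le assms by blast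
  show "T x y \<le> y" using le[of y x] T(1)[of x y] assms by auto
  show "T d y = y" using T(1)[of d y] T(2)[of y] assms by auto
  show "T x y \<le> T x' y" if "x' \<in> {c..d}" "x \<le> x'"
    using mono_onD[OF T(3)[OF assms(3)]] assms(2) that by blast
qed

lemma tconorm_ordinal_sum_ge:
  assumes "tconorm_on a b S"
  shows "x \<le> tconorm_ordinal_sum a b S x y" "y \<le> tconorm_ordinal_sum a b S x y"
  using tconorm_onD(3,4)[OF assms, of x y] by (auto simp: tconorm_ordinal_sum_def)

lemma tnorm_ordinal_sum_le:
  assumes "tnorm_on c d T"
  shows "tnorm_ordinal_sum c d T x y \<le> x" "tnorm_ordinal_sum c d T x y \<le> y"
  using tnorm_onD(3,4)[OF assms, of x y] by (auto simp: tnorm_ordinal_sum_def)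

lemma tnorm_ordinal_sum_mono:
  assumes "tnorm_on c d T" "x \<le> x'"
  shows "tnorm_ordinal_sum c d T x y \<le> tnorm_ordinal_sum c d T x' y"
proof (cases "y \<in> {c..d}")
  case False
  then show ?thesis using assms(2) by (auto simp: tnorm_ordinal_sum_def)
next
  case y: True
  show ?thesis
  proof (cases "x \<in> {c..d}")
    case True
    then show ?thesis
      using y assms(2) tnorm_onD(3,4,6)[OF assms(1) True y]
      by (auto simp: tnorm_ordinal_sum_def)
  next
    case False
    then show ?thesis
      using y assms(2) tnorm_onD(1)[OF assms(1) _ y, of x']
      by (auto simp: tnorm_ordinal_sum_def)
  qed
qed

text \<open>For a triple not of the form on the right, some ordinal sum merely returns one of its
  arguments, and the inequality follows from general bounds. For the others, \<open>max l\<close>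
  and \<open>min r\<close> move an inner result that has left the outer block to the neutral element
  of that block, which has the same effect as the outer maximum or minimum.\<close>

lemma ordinal_sum_weakly_dominates_iff:
  assumes ab: "0 \<le> a" "b \<le> 1" and cd: "0 \<le> c" "d \<le> 1"
    and S: "tconorm_on a b S" and T: "tnorm_on c d T"
    and l: "l = max a c" and r: "r = min b d"
  shows "tconorm_ordinal_sum a b S \<ggreater>\<^sub>w tnorm_ordinal_sum c d T \<longleftrightarrow>
    (\<forall>x\<in>{l..r}. \<forall>y\<in>{c..d}. \<forall>z\<in>{a..b}. T (min r (S x z)) y \<le> S (max l (T x y)) z)"
proof -
  let ?S = "tconorm_ordinal_sum a b S" and ?T = "tnorm_ordinal_sum c d T"
  have *: "?S (?T x y) z = S (max l (T x y)) z" "?T (?S x z) y = T (min r (S x z)) y"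
    if "x \<in> {l..r}" "y \<in> {c..d}" "z \<in> {a..b}" for x y z
  proof -
    have x: "x \<in> {a..b}" "x \<in> {c..d}" using that l r by auto
    have T': "?T x y = T x y" "T x y \<in> {c..d}" "T x y \<le> x"
      using x that tnorm_onD(1,3)[OF T x(2) that(2)] by (auto simp: tnorm_ordinal_sum_def)
    have S': "?S x z = S x z" "S x z \<in> {a..b}" "x \<le> S x z"
      using x that tconorm_onD(1,3)[OF S x(1) that(3)] by (auto simp: tconorm_ordinal_sum_def)
    \<comment> \<open>Since \<open>T x y \<le> x \<le> b\<close>, the block \<open>{a..b}\<close>
      can only be left below \<open>a\<close>. Then the maximum is \<open>z\<close>, and so is
      \<open>S a z\<close>. The second equation is dual, with \<open>d\<close> in place of
      \<open>a\<close>.\<close>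
    show "?S (?T x y) z = S (max l (T x y)) z"
    proof (cases "T x y < a")
      case True
      then have "max l (T x y) = a" using T' l by auto
      then show ?thesis
        using True T' that tconorm_onD(5)[OF S that(3) that(3)]
        by (auto simp: tconorm_ordinal_sum_def)
    next
      case False
      then have "max l (T x y) = T x y" using T' l by auto
      then show ?thesis using False T' that x by (auto simp: tconorm_ordinal_sum_def)
    qed
    show "?T (?S x z) y = T (min r (S x z)) y"
    proof (cases "d < S x z")
      case True
      then have "min r (S x z) = d" using S' r by auto
      then show ?thesis
        using True S' that tnorm_onD(5)[OF T that(2) that(2)]
        by (auto simp: tnorm_ordinal_sum_def)
    next
      case False
      then have "min r (S x z) = S x z" using S' r by auto
      then show ?thesis using False S' that x by (auto simp: tnorm_ordinal_sum_def)
    qed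
  qed
  have trivial: "?T (?S x z) y \<le> ?S (?T x y) z"
    if outside: "\<not> (x \<in> {l..r} \<and> y \<in> {c..d} \<and> z \<in> {a..b})" for x y z
  proof -
    note ge = tconorm_ordinal_sum_ge[OF S] and le = tnorm_ordinal_sum_le[OF T]
    \<comment> \<open>If \<open>x\<close> or \<open>z\<close> is outside \<open>{a..b}\<close>, then
      \<open>?S x z\<close> is \<open>x\<close> or \<open>z\<close>: the left side is
      \<open>?T x y\<close> or at most \<open>z\<close>, and both are below the right side. If
      \<open>x\<close> or \<open>y\<close> is outside \<open>{c..d}\<close>, the argument is
      dual.\<close>
    consider "z \<notin> {a..b}" | "y \<notin> {c..d}" | "z \<in> {a..b}" "x \<notin> {a..b}" | "y \<in> {c..d}" "x \<notin> {c..d}"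
      using outside l r by fastforce
    then show ?thesis
    proof cases
      case 1
      then have "?S x z = max x z" by (auto simp: tconorm_ordinal_sum_def)
      then have "?T (?S x z) y = ?T x y \<or> ?T (?S x z) y \<le> z"
        using le(1)[of "?S x z" y] by (auto simp: max_def)
      then show ?thesis using ge[where x = "?T x y" and y = z] by auto
    next
      case 2
      then have "?T x y = min x y" by (auto simp: tnorm_ordinal_sum_def)
      then have "?S (?T x y) z = ?S x z \<or> y \<le> ?S (?T x y) z"
        using ge(1)[of "?T x y" z] by (auto simp: min_def)
      then show ?thesis using le[where x = "?S x z" and y = y] by auto
    next
      case 3
      then have "?S x z = z \<or> ?S x z = x" by (auto simp: tconorm_ordinal_sum_def)
      then show ?thesis
        using ge[where x = "?T x y" and y = z] le(1)[of z y] by auto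
    next
      case 4
      then have "?T x y = y \<or> ?T x y = x" by (auto simp: tnorm_ordinal_sum_def)
      then show ?thesis
        using le[where x = "?S x z" and y = y] ge(1)[of y z] by auto
    qed
  qed
  have sub: "{l..r} \<subseteq> {0..1}" "{c..d} \<subseteq> {0..1}" "{a..b} \<subseteq> {0..1}"
    using ab cd l r by auto
  show ?thesis
  proof
    assume dom: "?S \<ggreater>\<^sub>w ?T"
    show "\<forall>x\<in>{l..r}. \<forall>y\<in>{c..d}. \<forall>z\<in>{a..b}. T (min r (S x z)) y \<le> S (max l (T x y)) z"
    proof (intro ballI)
      fix x y z assume xyz: "x \<in> {l..r}" "y \<in> {c..d}" "z \<in> {a..b}"
      then have "?T (?S x z) y \<le> ?S (?T x y) z"
        using dom sub unfolding weakly_dominates_def by blast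
      then show "T (min r (S x z)) y \<le> S (max l (T x y)) z" using *[OF xyz] by simp
    qed
  next
    assume core: "\<forall>x\<in>{l..r}. \<forall>y\<in>{c..d}. \<forall>z\<in>{a..b}. T (min r (S x z)) y \<le> S (max l (T x y)) z"
    show "?S \<ggreater>\<^sub>w ?T"
      unfolding weakly_dominates_def
    proof (intro ballI)
      fix x y z
      show "?T (?S x z) y \<le> ?S (?T x y) z"
      proof (cases "x \<in> {l..r} \<and> y \<in> {c..d} \<and> z \<in> {a..b}")
        case True
        then show ?thesis using core *[of x y z] by simp
      next
        case False
        then show ?thesis by (rule trivial)
      qed
    qed
  qed
qed

section \<open>Values of additive generators\<close>

text \<open>The truncated sum lies between \<open>s a = 0\<close> and \<open>s b\<close>, so by the
  intermediate value theorem it is a value of \<open>s\<close>, and \<open>inv_into\<close> really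
  inverts \<open>s\<close> there.\<close>

lemma tconorm_generator_value:
  assumes gen: "tconorm_additive_generator a b S s" and xy: "x \<in> {a..b}" "y \<in> {a..b}"
  shows "s (S x y) = min (s x + s y) (s b)"
proof -
  have s: "continuous_on {a..b} s" "s a = 0"
    and eq: "S x y = inv_into {a..b} s (min (s x + s y) (s b))"
    using gen xy by (auto simp: tconorm_additive_generator_def)
  obtain w where "a \<le> w" "w \<le> b" "s w = min (s x + s y) (s b)"
    using IVT'[of s a "min (s x + s y) (s b)" b] s xy by auto
  then show ?thesis unfolding eq by (intro f_inv_into_f) (metis atLeastAtMost_iff imageI)
qed

text \<open>For the generator \<open>t\<close> this identifies \<open>{t r..t l}\<close> as the
  image of the common block and gives every value up to \<open>t c\<close> a preimage in
  \<open>{c..d}\<close>.\<close>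

lemma image_Icc_antimono_on:
  fixes f :: "'a::linear_continuum_topology \<Rightarrow> 'b::linorder_topology"
  assumes "continuous_on {p..q} f" "antimono_on {p..q} f" "p \<le> q"
  shows "f ` {p..q} = {f q..f p}"
proof
  show "f ` {p..q} \<subseteq> {f q..f p}"
    using monotone_onD[OF assms(2), of p] monotone_onD[OF assms(2), of _ q] assms(3) by auto
  show "{f q..f p} \<subseteq> f ` {p..q}"
  proof
    fix v assume "v \<in> {f q..f p}"
    then obtain w where "p \<le> w" "w \<le> q" "f w = v" using IVT2'[of f q v p] assms by auto
    then show "v \<in> f ` {p..q}" by auto
  qed
qed

lemma tnorm_generator_value:
  assumes gen: "tnorm_additive_generator c d T t" and xy: "x \<in> {c..d}" "y \<in> {c..d}"
  shows "t (T x y) = min (t x + t y) (t c)"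
proof -
  have eq: "T x y = inv_into {c..d} t (min (t x + t y) (t c))"
    using gen xy by (auto simp: tnorm_additive_generator_def)
  have "min (t x + t y) (t c) \<in> t ` {c..d}"
    using image_Icc_antimono_on[of c d t] gen xy
    by (auto simp: tnorm_additive_generator_def strict_antimono_iff_antimono)
  then show ?thesis unfolding eq by (rule f_inv_into_f)
qed

section \<open>Weak domination and convexity of \<open>h\<close>\<close>

theorem theorem3p11:
  fixes a b c d l r :: real
    and S T :: "real \<Rightarrow> real \<Rightarrow> real"
    and s t :: "real \<Rightarrow> ennreal"
  assumes "0 \<le> a" "a < b" "b \<le> 1"
    and "0 \<le> c" "c < d" "d \<le> 1"
    and "{a<..<b} \<inter> {c<..<d} \<noteq> {}"
    and "continuous_archimedean_tconorm_on a b S"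
    and "tconorm_additive_generator a b S s"
    and "continuous_archimedean_tnorm_on c d T"
    and "tnorm_additive_generator c d T t"
    and "l = max a c" "r = min b d"
  shows "tconorm_ordinal_sum a b S \<ggreater>\<^sub>w tnorm_ordinal_sum c d T \<longleftrightarrow>
         ennreal_convex_on {t r..t l} (s \<circ> inv_into {c..d} t)"
proof -
  note S_gen = \<open>tconorm_additive_generator a b S s\<close>
  note T_gen = \<open>tnorm_additive_generator c d T t\<close>
  note l = \<open>l = max a c\<close> and r = \<open>r = min b d\<close>
  have S: "tconorm_on a b S"
    using \<open>continuous_archimedean_tconorm_on a b S\<close>
    by (simp add: continuous_archimedean_tconorm_on_def)
  have T: "tnorm_on c d T"
    using \<open>continuous_archimedean_tnorm_on c d T\<close>
    by (simp add: continuous_archimedean_tnorm_on_def)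
  have s: "continuous_on {a..b} s" "strict_mono_on {a..b} s" "s a = 0"
    using S_gen by (auto simp: tconorm_additive_generator_def)
  have t: "continuous_on {c..d} t" "strict_antimono_on {c..d} t" "t d = 0"
    using T_gen by (auto simp: tnorm_additive_generator_def)
  have s_le: "s x \<le> s y \<longleftrightarrow> x \<le> y" if "x \<in> {a..b}" "y \<in> {a..b}" for x y
    using strict_mono_on_leD[OF s(2)] monotone_onD[OF s(2), of y x] that
    by (meson not_le)
  have t_le: "t x \<le> t y \<longleftrightarrow> y \<le> x" if "x \<in> {c..d}" "y \<in> {c..d}" for x y
    using monotone_onD[OF t(2), of x y] monotone_onD[OF t(2), of y x] that
    by (metis linorder_not_le order_le_less)
  have t_inj: "inj_on t {c..d}" and t_anti: "antimono_on {c..d} t"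
    using t(2) by (simp_all add: strict_antimono_iff_antimono)
  have lr: "l < r" using assms(7) l r by auto
  have sub: "{l..r} \<subseteq> {a..b}" "{l..r} \<subseteq> {c..d}" using l r by auto
  have t_image: "t ` {l..r} = {t r..t l}"
    using t(1) t_anti sub(2) lr
    by (intro image_Icc_antimono_on) (auto intro: continuous_on_subset monotone_on_subset)
  define h where "h = s \<circ> inv_into {c..d} t"
  have h_t: "h (t x) = s x" if "x \<in> {c..d}" for x
    using that by (simp add: h_def inv_into_f_f[OF t_inj])
  have cont_h: "continuous_on {t r..t l} h"
  proof -
    \<comment> \<open>A continuous injection on a compact set has a continuous inverse on its
      image.\<close>
    have "continuous_on (t ` {l..r}) (inv_into {c..d} t)"
      using t(1) sub(2) by (intro continuous_on_inv)
        (auto intro: continuous_on_subset inv_into_f_f[OF t_inj])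
    moreover have "inv_into {c..d} t ` t ` {l..r} \<subseteq> {a..b}"
      using sub inv_into_f_f[OF t_inj] by auto
    ultimately show ?thesis
      unfolding h_def t_image[symmetric] by (intro continuous_on_compose continuous_on_subset[OF s(1)])
  qed
  have anti_h: "antimono_on {t r..t l} h"
    unfolding t_image[symmetric]
    using sub s_le t_le h_t by (intro monotone_onI) (auto simp: subset_iff)
  let ?core = "\<forall>x\<in>{l..r}. \<forall>y\<in>{c..d}. \<forall>z\<in>{a..b}. T (min r (S x z)) y \<le> S (max l (T x y)) z"
  have "?core \<longleftrightarrow> ennreal_convex_on {t r..t l} h"
  proof
    assume core: ?core
    \<comment> \<open>The increment inequality for \<open>h\<close>, with \<open>t x'\<close>,
      \<open>t x\<close> and \<open>v\<close> as \<open>u'\<close>, \<open>u\<close> and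
      \<open>v\<close>. It comes from \<open>core\<close> by choosing \<open>z\<close> with
      \<open>S x z = x'\<close> and \<open>y\<close> with \<open>T x' y = p\<close> and
      \<open>T x y = m\<close>.\<close>
    have four_point: "s p + s x \<le> s x' + s m"
      if pts: "p \<in> {l..r}" "x \<in> {l..r}" "x' \<in> {l..r}" "m \<in> {l..r}"
        and "x \<le> x'" and eqs: "t p = t x' + v" "t m = t x + v" for p x x' m v
    proof (cases "s x' = top")
      case True
      then show ?thesis by simp
    next
      case False
      note cd = pts[THEN subsetD[OF sub(2)]] and ab = pts[THEN subsetD[OF sub(1)]]
      define w where "w = s x' - s x"
      have w: "s x + w = s x'"
        using s_le[OF ab(2,3)] \<open>x \<le> x'\<close> by (simp add: w_def add_diff_self_ennreal)
      have "w \<le> s x + w" by simp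
      also have "\<dots> \<le> s b" using s_le[OF ab(3), of b] ab(3) w by auto
      finally obtain z where z: "z \<in> {a..b}" "s z = w"
        using IVT'[of s a w b] s assms(2) by auto
      have "v \<le> t m" using eqs by simp
      also have "\<dots> \<le> t c" using t_le[OF cd(4), of c] cd(4) by auto
      finally obtain y where y: "y \<in> {c..d}" "t y = v"
        using image_Icc_antimono_on[OF t(1) t_anti] t(3) assms(5)
        by (metis atLeastAtMost_iff imageE less_imp_le zero_le)
      have "s (S x z) = s x'"
        using tconorm_generator_value[OF S_gen ab(2) z(1)] w z s_le[OF ab(3), of b] ab(3)
        by (auto simp: min_def)
      then have "S x z = x'"
        using s_le tconorm_onD(1)[OF S ab(2) z(1)] ab(3) by (metis order_antisym order_refl)
      \<comment> \<open>Both sums are values of \<open>t\<close> on \<open>{c..d}\<close>, hence at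
        most \<open>t c\<close>, so the truncation is inactive.\<close>
      moreover have "t (T x' y) = t p" "t (T x y) = t m"
        using tnorm_generator_value[OF T_gen _ y(1)] cd y eqs t_le[OF cd(1), of c] t_le[OF cd(4), of c]
        by (auto simp: min_absorb1)
      then have "T x' y = p" "T x y = m"
        using tnorm_onD(1)[OF T _ y(1)] cd inj_onD[OF t_inj] by metis+
      \<comment> \<open>Since \<open>x'\<close> and \<open>m\<close> lie in \<open>{l..r}\<close>,
        neither \<open>min r\<close> nor \<open>max l\<close> changes them.\<close>
      ultimately have "p \<le> S m z"
        using core[rule_format, OF pts(2) y(1) z(1)] pts by (simp add: min_def max_def split: if_splits)
      then have "s p \<le> s (S m z)"
        using s_le ab(1) tconorm_onD(1)[OF S ab(4) z(1)] by simp
      also have "\<dots> \<le> s m + w"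
        using tconorm_generator_value[OF S_gen ab(4) z(1)] z(2) by simp
      finally have "s p + s x \<le> s m + w + s x" by (rule add_right_mono)
      then show ?thesis by (simp add: w[symmetric] ac_simps)
    qed
    show "ennreal_convex_on {t r..t l} h"
    proof (rule ennreal_convex_onI_midpoint[OF cont_h anti_h])
      fix \<xi> e :: real
      assume e: "0 < e" "e \<le> \<xi>" "t r \<le> ennreal (\<xi> - e)" "ennreal (\<xi> + e) \<le> t l"
      have "ennreal (\<xi> - e) \<le> ennreal \<xi>" "ennreal \<xi> \<le> ennreal (\<xi> + e)"
        using e by (auto intro: ennreal_leI)
      then have "ennreal (\<xi> - e) \<in> t ` {l..r}" "ennreal \<xi> \<in> t ` {l..r}" "ennreal (\<xi> + e) \<in> t ` {l..r}"
        unfolding t_image atLeastAtMost_iff using e(3,4) by (meson order_trans)+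
      then obtain x' x m where pts: "x' \<in> {l..r}" "x \<in> {l..r}" "m \<in> {l..r}"
        and ts: "t x' = ennreal (\<xi> - e)" "t x = ennreal \<xi>" "t m = ennreal (\<xi> + e)"
        by (metis imageE)
      have "t x' \<le> t x" using ts e by (auto intro: ennreal_leI)
      then have "x \<le> x'" using t_le pts sub(2) by blast
      moreover have "t x = t x' + ennreal e" "t m = t x + ennreal e"
        using ts e by (auto simp: ennreal_plus[symmetric] simp del: ennreal_plus)
      \<comment> \<open>The midpoint inequality is the case \<open>p = x\<close>,
        \<open>v = e\<close> of the four-point inequality.\<close>
      ultimately have "s x + s x \<le> s x' + s m" using four_point pts by blast
      then show "h (ennreal \<xi>) + h (ennreal \<xi>) \<le> h (ennreal (\<xi> - e)) + h (ennreal (\<xi> + e))"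
        using h_t pts sub(2) ts by (metis subsetD)
    qed
  next
    assume conv: "ennreal_convex_on {t r..t l} h"
    show ?core
    proof (intro ballI)
      fix x y z
      assume xyz: "x \<in> {l..r}" "y \<in> {c..d}" "z \<in> {a..b}"
      have x: "x \<in> {a..b}" "x \<in> {c..d}" using xyz sub by auto
      have Sxz: "S x z \<in> {a..b}" "x \<le> S x z" using tconorm_onD[OF S x(1) xyz(3)] by auto
      have Txy: "T x y \<in> {c..d}" "T x y \<le> x" using tnorm_onD[OF T x(2) xyz(2)] by auto
      define x' where "x' = min r (S x z)"
      define m where "m = max l (T x y)"
      have x': "x' \<in> {l..r}" "x' \<in> {a..b}" "x' \<in> {c..d}" "x \<le> x'"
        using xyz Sxz sub by (auto simp: x'_def)
      have m: "m \<in> {l..r}" "m \<in> {a..b}" "m \<in> {c..d}"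
        using xyz Txy sub by (auto simp: m_def)
      have Tx'y: "T x' y \<in> {c..d}" "T x' y \<le> x'" "T x' y \<le> y"
        using tnorm_onD[OF T x'(3) xyz(2)] by auto
      have Smz: "S m z \<in> {a..b}" "m \<le> S m z" "z \<le> S m z" using tconorm_onD[OF S m(2) xyz(3)] by auto
      have "T x' y \<le> S m z"
      \<comment> \<open>The first alternative suffices because \<open>m \<le> S m z\<close>; if
        \<open>s x\<close> is infinite, then \<open>x' = x\<close> and the first alternative holds.
        In the remaining case \<open>s x\<close> is finite and can be cancelled later.\<close>
      proof (cases "T x' y \<le> m \<or> s x = top")
        case True
        have "x' = x" if "s x = top"
          using s_le[OF x'(2) x(1)] that x'(4) by simp
        then show ?thesis
          using True Smz(2) by (auto simp: m_def)
      next
        case False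
        then have Tx'y': "T x' y \<in> {l..r}" using m x' Tx'y by auto
        text \<open>Truncating \<open>t y\<close> keeps \<open>t x + v\<close> in the interval on which \<open>h\<close> is convex.\<close>
        define v where "v = min (t y) (t l - t x)"
        have tx_le: "t x \<le> t l" using t_le x(2) sub(2) xyz(1) lr by auto
        have tl_le: "t l \<le> t c" using t_le sub(2) lr by auto
        have t_max: "t (max l q) = min (t l) (t q)" if "q \<in> {c..d}" for q
          using t_le[of l q] t_le[of q l] that sub(2) lr by (auto simp: max_def min_def)
        have "t (T x' y) < t m" "t m \<le> t l"
          using False t_le Tx'y(1) m sub(2) lr by (auto simp: not_le[symmetric])
        have tm: "t m = min (t l) (t x + t y)"
          using t_max[OF Txy(1)] tnorm_generator_value[OF T_gen x(2) xyz(2)] tl_le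
          by (auto simp: m_def min_def)
        \<comment> \<open>Adding \<open>t x\<close> commutes with the minimum, and
          \<open>t x \<le> t l\<close> makes the difference in \<open>v\<close> exact.\<close>
        have tm_v: "t x + v = t m"
          using tx_le min_of_mono[of "(+) (t x)" "t y" "t l - t x"]
          by (simp add: tm v_def mono_def add_left_mono add_diff_self_ennreal min.commute)
        show ?thesis
        \<comment> \<open>Convexity speaks only of finite points, so an infinite \<open>t m\<close>
          is treated directly: it forces \<open>m = x\<close>, and then
          \<open>T x' y \<le> x' \<le> S x z\<close>.\<close>
        proof (cases "t m = top")
          case True
          have "t y \<noteq> top"
          proof
            assume "t y = top"
            then have "y \<le> m" using t_le[of m y] m(3) xyz(2) by simp
            then show False using False Tx'y(3) by auto
          qed
          then have "t x = t m" using True tm by (auto simp: min_def top_unique split: if_splits)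
          then have "m = x" using inj_onD[OF t_inj] x(2) m(3) by metis
          then show ?thesis using Tx'y(2) by (auto simp: x'_def)
        next
          case fin: False
          have "h (t x' + v) + h (t x) \<le> h (t x') + h (t x + v)"
            using ennreal_convex_on_increments[OF conv, of "t x'" "t x" v]
              t_le x' x sub(2) lr m tm_v fin by (auto simp: less_top)
          then have "h (t x' + v) + s x \<le> s x' + s m"
            using h_t x x' m tm_v by simp
          also have "s x' \<le> s (S x z)" using s_le x'(2) Sxz(1) by (simp add: x'_def)
          also have "\<dots> \<le> s x + s z"
            using tconorm_generator_value[OF S_gen x(1) xyz(3)] by simp
          finally have "s x + h (t x' + v) \<le> s x + (s m + s z)" by (simp add: ac_simps add_right_mono)
          then have h_le: "h (t x' + v) \<le> s m + s z"
            using False by (simp add: ennreal_add_left_cancel_le)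
          have v_le: "t x' + v \<le> t l"
            using add_right_mono[of "t x'" "t x" v] t_le[OF x'(3) x(2)] x'(4) tm_v \<open>t m \<le> t l\<close>
            by auto
          \<comment> \<open>Truncating \<open>t y\<close> to \<open>v\<close> can only decrease the
            sum, and \<open>t x' + v \<le> t l \<le> t c\<close>. As \<open>h\<close> is decreasing,
            its bound at \<open>t x' + v\<close> carries over to \<open>t (T x' y)\<close>.\<close>
          then have "t x' + v \<le> t (T x' y)"
            using tnorm_generator_value[OF T_gen x'(3) xyz(2)] tl_le
            by (auto simp: v_def intro: add_left_mono)
          moreover have "t r \<le> t x' + v"
            using t_le[of r x'] x'(1,3) sub(2) lr by (auto intro: add_increasing2)
          moreover have "t (T x' y) \<in> {t r..t l}" using Tx'y' t_image by auto
          ultimately have "h (t (T x' y)) \<le> h (t x' + v)"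
            using v_le by (intro monotone_onD[OF anti_h]) auto
          then have "s (T x' y) \<le> min (s m + s z) (s b)"
            using h_le h_t[OF Tx'y(1)] s_le[of "T x' y" b] Tx'y' sub(1) assms(2) by auto
          then show ?thesis
            using tconorm_generator_value[OF S_gen m(2) xyz(3)]
              s_le[OF subsetD[OF sub(1) Tx'y'] Smz(1)] by simp
        qed
      qed
      then show "T (min r (S x z)) y \<le> S (max l (T x y)) z"
        by (simp add: x'_def m_def)
    qed
  qed
  moreover have "tconorm_ordinal_sum a b S \<ggreater>\<^sub>w tnorm_ordinal_sum c d T \<longleftrightarrow> ?core"
    using assms(1-6) S T l r by (intro ordinal_sum_weakly_dominates_iff) auto
  ultimately show ?thesis by (simp add: h_def)
qed

end
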